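(* For every $n\ge1$, $d\ge 1$, $L\in(0,\infty)$ and $\delta>0$ there is a constant $K_{n,d,L,\delta}$, depending only on the cardinality $n$, the dimension $d$, the radius $L$ and the separation threshold $\delta$, such that for all finite point sets $X,Y\in\mathcal{C}_n^{\delta}(\mathbb{R}^d)$ contained within the disk of radius $L$ centered at the origin, $$d_{L^1}(\mathrm{Mag}_X,\mathrm{Mag}_Y)\le K_{n,d,L,\delta}\cdot d_{W,\infty}(X,Y).$$
   Context: Thick configuration space (barycenter at the origin): $\mathcal{C}_n^{\delta}(\mathbb{R}^d)=\{(x_1,\dots,x_n)\in(\mathbb{R}^d)^n\mid \sum_{i=1}^n x_i=0,\ \|x_i-x_j\|\ge\delta\text{ for }i\ne j\}$, with $\|\cdot\|$ the Euclidean norm; an element is identified with the point set $\{x_1,\dots,x_n\}$. Magnitude: for a finite set $A=\{a_1,\dots,a_m\}\subset\mathbb{R}^d$ of $m$ distinct points, let $Z_{ij}=e^{-\|a_i-a_j\|}$ (an invertible matrix); $\mathrm{Mag}(A)=\mathbf{1}^TZ^{-1}\mathbf{1}=\sum_{i,j}(Z^{-1})_{ij}$, and $\mathrm{Mag}(\emptyset)=0$. Magnitude profile: $\mathrm{Mag}_X(r)=\mathrm{Mag}(\mathcal{N}_r(X))$, where $\mathcal{N}_r(X)=\{x\in X\mid\|x-u_X\|\le r\}$ and $u_X$ is the barycenter of $X$ (here the origin). Distances: $d_{L^1}(f,g)=\int_0^L|f(r)-g(r)|\,dr$ (with the same $L$ as the radius of the disk), and $d_{W,\infty}(X,Y)=\inf_{\gamma}\max_{x\in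 X}\|x-\gamma(x)\|$, the infimum over all bijections $\gamma:X\to Y$. *)

theory Defs
  imports "HOL-Analysis.Analysis" "Jordan_Normal_Form.Gauss_Jordan_Elimination"
begin

text \<open>Configurations are \<open>n\<close>-tuples, represented as lists of length \<open>n\<close>; passing to the
  underlying point set (\<^const>\<open>set\<close>) loses only the order, as the points are distinct for
  \<open>\<delta> > 0\<close>.\<close>

definition thick_config :: "nat \<Rightarrow> real \<Rightarrow> (real ^ 'd) list set" where
  "thick_config n \<delta> =
     {xs. length xs = n \<and> sum_list xs = 0 \<and>
          (\<forall>i<n. \<forall>j<n. i \<noteq> j \<longrightarrow> norm (xs ! i - xs ! j) \<ge> \<delta>)}"

definition thick_config_sets :: "nat \<Rightarrow> real \<Rightarrow> (real ^ 'd) set set" where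
  "thick_config_sets n \<delta> = set ` thick_config n \<delta>"

definition similarity_matrix :: "(real ^ 'd) list \<Rightarrow> real mat" where
  "similarity_matrix as =
     mat (length as) (length as) (\<lambda>(i, j). exp (- norm (as ! i - as ! j)))"

text \<open>The magnitude of a finite set is computed from an arbitrary enumeration of it without
  repetitions; another enumeration permutes the rows and columns of the similarity matrix
  simultaneously, so the sum of the entries of the inverse does not depend on the choice. The
  similarity matrix of distinct points in Euclidean space is invertible, so \<^const>\<open>mat_inverse\<close>
  returns \<^const>\<open>Some\<close> of the inverse. For the empty set the double sum is empty, hence \<open>0\<close>.\<close>

definition magnitude :: "(real ^ 'd) set \<Rightarrow> real" where
  "magnitude A =
     (let as = (SOME as. distinct as \<and> set as = A);
          Zinv = the (mat_inverse (similarity_matrix as))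
      in \<Sum>i<length as. \<Sum>j<length as. Zinv $$ (i, j))"

definition barycenter :: "(real ^ 'd) set \<Rightarrow> real ^ 'd" where
  "barycenter X = (1 / real (card X)) *\<^sub>R (\<Sum>x\<in>X. x)"

definition barycentric_nbhd :: "real \<Rightarrow> (real ^ 'd) set \<Rightarrow> (real ^ 'd) set" where
  "barycentric_nbhd r X = {x \<in> X. norm (x - barycenter X) \<le> r}"

definition magnitude_profile :: "(real ^ 'd) set \<Rightarrow> real \<Rightarrow> real" where
  "magnitude_profile X r = magnitude (barycentric_nbhd r X)"

definition L1_dist :: "real \<Rightarrow> (real \<Rightarrow> real) \<Rightarrow> (real \<Rightarrow> real) \<Rightarrow> real" where
  "L1_dist L f g = integral {0..L} (\<lambda>r. \<bar>f r - g r\<bar>)"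

text \<open>Intended for finite nonempty \<open>X\<close> and \<open>Y\<close> of equal cardinality: then \<^const>\<open>Max\<close> is taken
  over a finite nonempty set and the infimum over a nonempty set of nonnegative reals.\<close>

definition W_inf_dist :: "(real ^ 'd) set \<Rightarrow> (real ^ 'd) set \<Rightarrow> real" where
  "W_inf_dist X Y =
     (INF \<gamma>\<in>{\<gamma>. bij_betw \<gamma> X Y}. Max ((\<lambda>x. norm (x - \<gamma> x)) ` X))"

end

theory Submission
  imports Defs "Jordan_Normal_Form.Determinant" "HOL-Real_Asymp.Real_Asymp"
begin

text \<open>The kernel \<open>exp (- norm (x - y))\<close> is a mixture of the Gaussian kernels
  \<open>exp (- (t * (norm (x - y))\<^sup>2))\<close>, all of which are positive semidefinite and those with large
  \<open>t\<close> are diagonally dominant, hence coercive, on \<open>\<delta>\<close>-separated sets. So the similarity matrix of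
  at most \<open>n\<close> \<open>\<delta>\<close>-separated points has a spectral gap \<open>\<mu>\<close> depending on \<open>n\<close> and \<open>\<delta>\<close> only, and
  its weighting \<open>w\<close> (the solution of \<open>Z w = 1\<close>) has \<open>l\<^sup>1\<close>-norm at most \<open>n / \<mu>\<close>. As
  \<open>Mag A - Mag B = w\<^sub>A\<^sup>T (Z\<^sub>B - Z\<^sub>A) w\<^sub>B\<close>, magnitude is bounded and Lipschitz under matchings. A
  bijection moving points by at most \<open>\<epsilon>\<close> matches the neighbourhoods of radius \<open>r\<close>, unless \<open>r\<close>
  lies in one of \<open>n\<close> intervals of length at most \<open>\<epsilon>\<close>, where the bound on magnitude suffices.\<close>

section \<open>The Gaussian integral and subordination\<close>

text \<open>Since \<open>exp (- x\<^sup>2) \<le> inverse (1 + x\<^sup>2)\<close>, the antiderivative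
  vanishing at \<open>0\<close> stays below \<open>arctan\<close> on the positive half-line. So it
  is increasing and bounded, and oddness transfers the limit to \<open>at_bot\<close>.\<close>

lemma gaussian_primitive:
  obtains E :: "real \<Rightarrow> real" and C :: real
  where "\<And>x. (E has_real_derivative exp (- x\<^sup>2)) (at x)" "C > 0"
    "E 0 = 0" "(E \<longlongrightarrow> C) at_top" "(E \<longlongrightarrow> - C) at_bot"
proof -
  obtain F :: "real \<Rightarrow> real" where
    F: "\<And>x. (F has_vector_derivative exp (- x\<^sup>2)) (at x)"
    using einterval_antiderivative[of "-\<infinity>" \<infinity> "\<lambda>x::real. exp (- x\<^sup>2)"]
    by (auto intro!: continuous_intros)
  define E where "E x = F x - F 0" for x
  have dE: "(E has_real_derivative exp (- x\<^sup>2)) (at x)" for x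
    using F[of x] unfolding E_def has_real_derivative_iff_has_vector_derivative
    by (auto intro!: derivative_eq_intros)
  have E0: "E 0 = 0"
    by (simp add: E_def)
  have mono: "E x < E y" if "x < y" for x y
    using DERIV_pos_imp_increasing[OF that, of E] dE by (meson exp_gt_zero)
  have odd: "E (- x) = - E x" for x
  proof -
    have "((\<lambda>x. E (- x)) has_real_derivative exp (- (- y)\<^sup>2) * - 1) (at y)" for y
      by (rule DERIV_chain2[OF dE]) (auto intro!: derivative_eq_intros)
    from DERIV_add[OF dE this] have "((\<lambda>x. E x + E (- x)) has_real_derivative 0) (at y)" for y
      by simp
    then have "E x + E (- x) = E 0 + E (- 0)"
      by (intro DERIV_isconst_all[of "\<lambda>x. E x + E (- x)"]) auto
    then show ?thesis
      by (simp add: E0)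
  qed
  have arctan_bound: "E x \<le> arctan x" if "x \<ge> 0" for x
  proof -
    have "E 0 - arctan 0 \<ge> E x - arctan x"
    proof (rule DERIV_nonpos_imp_nonincreasing[OF that])
      fix y :: real
      have "1 + y\<^sup>2 \<le> exp (y\<^sup>2)"
        by (rule exp_ge_add_one_self)
      then have "exp (- y\<^sup>2) \<le> inverse (1 + y\<^sup>2)"
        by (simp add: exp_minus add_pos_nonneg le_imp_inverse_le)
      then show "\<exists>D. ((\<lambda>x. E x - arctan x) has_real_derivative D) (at y) \<and> D \<le> 0"
        using DERIV_diff[OF dE[of y] DERIV_arctan[of y]] by force
    qed
    then show ?thesis
      by (simp add: E0)
  qed
  have ub: "E x \<le> pi / 2" for x
    using arctan_bound[of x] arctan_ubound[of x] mono[of x 0] E0 pi_gt_zero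
    by linarith
  then have bdd: "bdd_above (range E)"
    by (intro bdd_aboveI[of _ "pi / 2"]) auto
  define C where "C = (SUP x. E x)"
  have le_C: "E x \<le> C" for x
    unfolding C_def by (rule cSUP_upper[OF _ bdd]) simp
  have "C > 0"
    using mono[of 0 1] le_C[of 1] E0 by simp
  moreover have top: "(E \<longlongrightarrow> C) at_top"
  proof (rule increasing_tendsto)
    show "\<forall>\<^sub>F x in at_top. E x \<le> C"
      using le_C by simp
  next
    fix c assume "c < C"
    then obtain y where "c < E y"
      unfolding C_def by (subst (asm) less_cSUP_iff[OF _ bdd]) auto
    then show "\<forall>\<^sub>F x in at_top. c < E x"
      using mono by (intro eventually_mono[OF eventually_gt_at_top[of y]]) force
  qed
  moreover have "(E \<longlongrightarrow> - C) at_bot"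
    using tendsto_minus[OF top] unfolding filterlim_at_bot_mirror odd .
  ultimately show ?thesis
    using that dE E0 by blast
qed

text \<open>For \<open>v > 0\<close> this is an antiderivative of the integrand in the subordination formula
  \<open>\<integral>\<^sub>0\<^sup>\<infinity> exp (- v\<^sup>2 - a\<^sup>2 / v\<^sup>2) dv = C * exp (- (2 * a))\<close>; its limits at \<open>\<infinity>\<close> and \<open>0\<close>
  replace the improper integral.\<close>

lemma subordination_primitive:
  fixes E :: "real \<Rightarrow> real" and a C :: real
  assumes dE: "\<And>x. (E has_real_derivative exp (- x\<^sup>2)) (at x)"
    and top: "(E \<longlongrightarrow> C) at_top" and bot: "(E \<longlongrightarrow> - C) at_bot"
    and E0: "E 0 = 0" and a: "a \<ge> 0"
  defines "F \<equiv> \<lambda>v. (exp (2 * a) * E (v + a / v) + exp (- (2 * a)) * E (v - a / v)) / 2"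
  shows "v > 0 \<Longrightarrow> (F has_real_derivative exp (- v\<^sup>2) * exp (- (a / v)\<^sup>2)) (at v)"
    and "(F \<longlongrightarrow> (exp (2 * a) + exp (- (2 * a))) / 2 * C) at_top"
    and "(F \<longlongrightarrow> (exp (2 * a) - exp (- (2 * a))) / 2 * C) (at_right 0)"
proof -
  assume v: "v > 0"
  have d1: "((\<lambda>v. v + a / v) has_real_derivative 1 - a / v\<^sup>2) (at v)"
    using v by (auto intro!: derivative_eq_intros simp: power2_eq_square)
  have d2: "((\<lambda>v. v - a / v) has_real_derivative 1 + a / v\<^sup>2) (at v)"
    using v by (auto intro!: derivative_eq_intros simp: power2_eq_square)
  \<comment> \<open>The cross terms \<open>2 * a\<close> and \<open>- 2 * a\<close> cancel against
    the prefactors of \<open>F\<close>, so both summands of the derivative carry the same Gaussian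
    factor.\<close>
  have sq: "(v + a / v)\<^sup>2 = v\<^sup>2 + (a / v)\<^sup>2 + 2 * a" "(v - a / v)\<^sup>2 = v\<^sup>2 + (a / v)\<^sup>2 - 2 * a"
    unfolding power2_sum power2_diff using v by simp_all
  have s1: "exp (2 * a) * exp (- (v + a / v)\<^sup>2) = exp (- v\<^sup>2) * exp (- (a / v)\<^sup>2)"
    unfolding exp_add[symmetric] sq by simp
  have s2: "exp (- (2 * a)) * exp (- (v - a / v)\<^sup>2) = exp (- v\<^sup>2) * exp (- (a / v)\<^sup>2)"
    unfolding exp_add[symmetric] sq by simp
  have "(F has_real_derivative
      (exp (2 * a) * (exp (- (v + a / v)\<^sup>2) * (1 - a / v\<^sup>2)) +
       exp (- (2 * a)) * (exp (- (v - a / v)\<^sup>2) * (1 + a / v\<^sup>2))) / 2) (at v)"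
    unfolding F_def
    by (intro DERIV_cdivide DERIV_add DERIV_cmult DERIV_chain2[OF dE] d1 d2)
  also have "exp (2 * a) * (exp (- (v + a / v)\<^sup>2) * (1 - a / v\<^sup>2)) +
       exp (- (2 * a)) * (exp (- (v - a / v)\<^sup>2) * (1 + a / v\<^sup>2)) =
      2 * (exp (- v\<^sup>2) * exp (- (a / v)\<^sup>2))"
    unfolding mult.assoc[symmetric] s1 s2 by (simp add: algebra_simps)
  finally show "(F has_real_derivative exp (- v\<^sup>2) * exp (- (a / v)\<^sup>2)) (at v)"
    by simp
next
  have 1: "filterlim (\<lambda>v. v + a / v) at_top at_top" "filterlim (\<lambda>v. v - a / v) at_top at_top"
    by real_asymp+
  have "(F \<longlongrightarrow> (exp (2 * a) * C + exp (- (2 * a)) * C) / 2) at_top"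
    unfolding F_def
    by (intro tendsto_intros filterlim_compose[OF top] 1) simp
  then show "(F \<longlongrightarrow> (exp (2 * a) + exp (- (2 * a))) / 2 * C) at_top"
    by (simp add: algebra_simps)
next
  show "(F \<longlongrightarrow> (exp (2 * a) - exp (- (2 * a))) / 2 * C) (at_right 0)"
  \<comment> \<open>For \<open>a = 0\<close> the arguments of \<open>E\<close> tend to
    \<open>0\<close> instead of diverging, and continuity of \<open>E\<close> replaces its limits at
    infinity.\<close>
  proof (cases "a = 0")
    case True
    have "(E \<longlongrightarrow> E 0) (at_right 0)"
      using DERIV_isCont[OF dE[of 0]] unfolding isCont_def
      by (rule tendsto_mono[rotated]) (simp add: at_le)
    then show ?thesis
      using True by (simp add: F_def E0)
  next
    case False
    with a have "a > 0" by simp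
    then have 1: "filterlim (\<lambda>v. v + a / v) at_top (at_right 0)"
      "filterlim (\<lambda>v. v - a / v) at_bot (at_right 0)"
      by real_asymp+
    have "(F \<longlongrightarrow> (exp (2 * a) * C + exp (- (2 * a)) * (- C)) / 2) (at_right 0)"
      unfolding F_def
      by (intro tendsto_intros filterlim_compose[OF top] filterlim_compose[OF bot] 1) simp
    then show ?thesis
      by (simp add: algebra_simps)
  qed
qed

section \<open>Positive semidefiniteness of Gaussian kernels\<close>

text \<open>Expanding one factor \<open>x \<bullet> y\<close> over the basis and absorbing the
  coordinates into the coefficients turns the form of degree \<open>Suc k\<close> into a sum of
  forms of degree \<open>k\<close>. This is why \<open>c\<close> is arbitrary in the
  induction.\<close>

lemma inner_power_form_nonneg:
  fixes A :: "'a::euclidean_space set" and c :: "'a \<Rightarrow> real"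
  shows "(\<Sum>x\<in>A. \<Sum>y\<in>A. c x * c y * (x \<bullet> y) ^ k) \<ge> 0"
proof (induction k arbitrary: c)
  case 0
  have "(\<Sum>x\<in>A. \<Sum>y\<in>A. c x * c y) = (\<Sum>x\<in>A. c x)\<^sup>2"
    by (simp add: power2_eq_square sum_product)
  then show ?case by simp
next
  case (Suc k)
  have "(\<Sum>x\<in>A. \<Sum>y\<in>A. c x * c y * (x \<bullet> y) ^ Suc k) =
      (\<Sum>x\<in>A. \<Sum>y\<in>A. \<Sum>b\<in>Basis. c x * (x \<bullet> b) * (c y * (y \<bullet> b)) * (x \<bullet> y) ^ k)"
  proof (intro sum.cong refl)
    fix x y
    have "c x * c y * (x \<bullet> y) ^ Suc k = (\<Sum>b\<in>Basis. (x \<bullet> b) * (y \<bullet> b)) * (c x * c y * (x \<bullet> y) ^ k)"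
      by (subst euclidean_inner[symmetric]) simp
    also have "\<dots> = (\<Sum>b\<in>Basis. c x * (x \<bullet> b) * (c y * (y \<bullet> b)) * (x \<bullet> y) ^ k)"
      unfolding sum_distrib_right by (intro sum.cong refl) (simp add: mult_ac)
    finally show "c x * c y * (x \<bullet> y) ^ Suc k =
        (\<Sum>b\<in>Basis. c x * (x \<bullet> b) * (c y * (y \<bullet> b)) * (x \<bullet> y) ^ k)" .
  qed
  also have "\<dots> = (\<Sum>b\<in>Basis. \<Sum>x\<in>A. \<Sum>y\<in>A. c x * (x \<bullet> b) * (c y * (y \<bullet> b)) * (x \<bullet> y) ^ k)"
    by (simp add: sum.swap[of _ _ Basis])
  also have "\<dots> \<ge> 0"
    by (intro sum_nonneg Suc.IH)
  finally show ?case .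
qed

text \<open>Rescaling the coefficients by \<open>exp (- (t * (norm x)\<^sup>2))\<close> leaves the
  kernel \<open>exp (2 * t * (x \<bullet> y))\<close>, whose power series combines the kernels
  \<open>(x \<bullet> y) ^ k\<close> with nonnegative coefficients.\<close>

lemma gaussian_form_nonneg:
  fixes A :: "'a::euclidean_space set" and c :: "'a \<Rightarrow> real"
  assumes "t \<ge> 0"
  shows "(\<Sum>x\<in>A. \<Sum>y\<in>A. c x * c y * exp (- (t * (norm (x - y))\<^sup>2))) \<ge> 0"
proof -
  define b where "b x = c x * exp (- (t * (norm x)\<^sup>2))" for x
  have eq: "c x * c y * exp (- (t * (norm (x - y))\<^sup>2)) = b x * b y * exp (2 * t * (x \<bullet> y))" for x y
  proof -
    have d: "(norm (x - y))\<^sup>2 = (norm x)\<^sup>2 + (norm y)\<^sup>2 - 2 * (x \<bullet> y)"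
      by (simp add: power2_norm_eq_inner inner_diff_left inner_diff_right inner_commute)
    have "exp (- (t * (norm (x - y))\<^sup>2)) =
        exp (- (t * (norm x)\<^sup>2)) * exp (- (t * (norm y)\<^sup>2)) * exp (2 * t * (x \<bullet> y))"
      unfolding d exp_add[symmetric] by (simp add: algebra_simps)
    then show ?thesis
      by (simp add: b_def)
  qed
  have "(\<lambda>k. \<Sum>x\<in>A. \<Sum>y\<in>A. b x * b y * ((2 * t * (x \<bullet> y)) ^ k /\<^sub>R fact k)) sums
      (\<Sum>x\<in>A. \<Sum>y\<in>A. b x * b y * exp (2 * t * (x \<bullet> y)))"
    by (intro sums_sum sums_mult exp_converges)
  moreover have "(\<Sum>x\<in>A. \<Sum>y\<in>A. b x * b y * ((2 * t * (x \<bullet> y)) ^ k /\<^sub>R fact k)) \<ge> 0" for k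
  proof -
    have "(\<Sum>x\<in>A. \<Sum>y\<in>A. b x * b y * ((2 * t * (x \<bullet> y)) ^ k /\<^sub>R fact k)) =
        (2 * t) ^ k / fact k * (\<Sum>x\<in>A. \<Sum>y\<in>A. b x * b y * (x \<bullet> y) ^ k)"
      by (simp add: sum_distrib_left power_mult_distrib field_simps)
    also have "\<dots> \<ge> 0"
      using assms by (intro mult_nonneg_nonneg inner_power_form_nonneg) simp
    finally show ?thesis .
  qed
  ultimately have "(\<Sum>x\<in>A. \<Sum>y\<in>A. b x * b y * exp (2 * t * (x \<bullet> y))) \<ge> 0"
    by (rule sums_le[OF _ sums_zero, rotated])
  then show ?thesis
    unfolding eq .
qed

section \<open>Spectral gap of the exponential kernel\<close>

lemma form_diagonally_dominant:
  fixes A :: "'a set" and c :: "'a \<Rightarrow> real"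
  assumes "finite A" and diag: "\<And>x. x \<in> A \<Longrightarrow> M x x = 1"
    and off: "\<And>x y. x \<in> A \<Longrightarrow> y \<in> A \<Longrightarrow> x \<noteq> y \<Longrightarrow> \<bar>M x y\<bar> \<le> \<eta>"
    and \<eta>: "\<eta> \<ge> 0" "real (card A) * \<eta> \<le> 1 / 2"
  shows "(\<Sum>x\<in>A. \<Sum>y\<in>A. c x * c y * M x y) \<ge> (\<Sum>x\<in>A. (c x)\<^sup>2) / 2"
proof -
  \<comment> \<open>The penalty from the inequality of arithmetic and geometric means is charged on
    the diagonal too. This only weakens the bound and gives the double sum a closed form.\<close>
  have le: "c x * c y * M x y \<ge> (if x = y then (c x)\<^sup>2 else 0) - \<eta> * ((c x)\<^sup>2 + (c y)\<^sup>2) / 2"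
    if "x \<in> A" "y \<in> A" for x y
  proof (cases "x = y")
    case True
    then show ?thesis
      using diag[OF that(1)] \<eta> by (simp add: power2_eq_square)
  next
    case False
    have "\<bar>c x * c y\<bar> \<le> ((c x)\<^sup>2 + (c y)\<^sup>2) / 2"
      using zero_le_power2[of "c x - c y"] zero_le_power2[of "c x + c y"]
      by (auto simp: power2_eq_square algebra_simps abs_if)
    then have "\<bar>c x * c y * M x y\<bar> \<le> ((c x)\<^sup>2 + (c y)\<^sup>2) / 2 * \<eta>"
      unfolding abs_mult[of "c x * c y"] using off[OF that False] by (intro mult_mono) auto
    then show ?thesis
      using False by (simp add: mult.commute abs_le_iff)
  qed
  have "(\<Sum>x\<in>A. \<Sum>y\<in>A. (if x = y then (c x)\<^sup>2 else 0) - \<eta> * ((c x)\<^sup>2 + (c y)\<^sup>2) / 2) =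
      (\<Sum>x\<in>A. (c x)\<^sup>2) - real (card A) * \<eta> * (\<Sum>x\<in>A. (c x)\<^sup>2)"
    using \<open>finite A\<close>
    by (simp add: sum_subtractf sum.distrib sum_divide_distrib[symmetric] sum_distrib_left[symmetric]
        distrib_left mult_ac flip: sum_distrib_right)
  moreover have "real (card A) * \<eta> * (\<Sum>x\<in>A. (c x)\<^sup>2) \<le> 1 / 2 * (\<Sum>x\<in>A. (c x)\<^sup>2)"
    using \<eta> by (intro mult_right_mono sum_nonneg) auto
  moreover have "(\<Sum>x\<in>A. \<Sum>y\<in>A. c x * c y * M x y) \<ge>
      (\<Sum>x\<in>A. \<Sum>y\<in>A. (if x = y then (c x)\<^sup>2 else 0) - \<eta> * ((c x)\<^sup>2 + (c y)\<^sup>2) / 2)"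
    by (intro sum_mono le)
  ultimately show ?thesis
    by linarith
qed

text \<open>Bounding the cardinality instead of fixing it lets the predicate pass to subsets, hence
  to all neighbourhoods in a configuration, with the same \<open>n\<close> and
  \<open>\<delta>\<close>.\<close>

definition separated :: "nat \<Rightarrow> real \<Rightarrow> 'a::real_normed_vector set \<Rightarrow> bool" where
  "separated n \<delta> A \<longleftrightarrow> finite A \<and> card A \<le> n \<and> pairwise (\<lambda>x y. \<delta> \<le> norm (x - y)) A"

text \<open>Subordination with \<open>a = norm (x - y) / 2\<close> writes \<open>C\<close> times the
  form as the integral over \<open>v > 0\<close> of \<open>exp (- v\<^sup>2)\<close> times a
  Gaussian form. That form is never negative, and for small \<open>v\<close> diagonal dominance
  bounds it below; this range alone yields \<open>\<mu>\<close>.\<close>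

lemma exponential_form_coercive:
  fixes \<delta> :: real and n :: nat
  assumes "n \<ge> 1" "\<delta> > 0"
  shows "\<exists>\<mu>>0. \<forall>(A :: 'a::euclidean_space set) c. separated n \<delta> A \<longrightarrow>
    \<mu> * (\<Sum>x\<in>A. (c x)\<^sup>2) \<le> (\<Sum>x\<in>A. \<Sum>y\<in>A. c x * c y * exp (- norm (x - y)))"
proof -
  obtain E :: "real \<Rightarrow> real" and C where
    dE: "\<And>x. (E has_real_derivative exp (- x\<^sup>2)) (at x)" and C: "C > 0"
    and E0: "E 0 = 0" and top: "(E \<longlongrightarrow> C) at_top" and bot: "(E \<longlongrightarrow> - C) at_bot"
    using gaussian_primitive by blast
  define F where
    "F a v = (exp (2 * a) * E (v + a / v) + exp (- (2 * a)) * E (v - a / v)) / 2" for a v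
  note F = subordination_primitive[OF dE top bot E0, folded F_def]
  \<comment> \<open>Chosen so that \<open>4 * v0\<^sup>2 / \<delta>\<^sup>2 = 1 / (4 * (real
    n)\<^sup>2)\<close>; multiplied by \<open>n\<close> this is at most \<open>1 / 2\<close>, as
    diagonal dominance demands.\<close>
  define v0 where "v0 = \<delta> / (4 * real n)"
  have v0: "v0 > 0"
    using assms by (simp add: v0_def)
  \<comment> \<open>The least Gaussian weight on \<open>(0, v0]\<close>, times the constant
    \<open>1 / 2\<close> of diagonal dominance, times the length \<open>v0\<close>, divided by
    \<open>C\<close>.\<close>
  define \<mu> where "\<mu> = exp (- v0\<^sup>2) / 2 * v0 / C"
  have "\<mu> > 0"
    using v0 C by (simp add: \<mu>_def)
  moreover have "\<mu> * (\<Sum>x\<in>A. (c x)\<^sup>2) \<le> (\<Sum>x\<in>A. \<Sum>y\<in>A. c x * c y * exp (- norm (x - y)))"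
    if "separated n \<delta> A" for A :: "'a set" and c
  proof -
    have A: "finite A" "card A \<le> n" "pairwise (\<lambda>x y. \<delta> \<le> norm (x - y)) A"
      using that by (auto simp: separated_def)
    define q where
      \<comment> \<open>The Gaussian parameter is \<open>t = 1 / (4 * v\<^sup>2)\<close>, because
        \<open>(norm (x - y) / 2 / v)\<^sup>2\<close> is the exponent from subordination; small
        \<open>v\<close> means large \<open>t\<close>.\<close>
      "q v = (\<Sum>x\<in>A. \<Sum>y\<in>A. c x * c y * exp (- ((1 / (4 * v\<^sup>2)) * (norm (x - y))\<^sup>2)))" for v :: real
    define S where "S = (\<Sum>x\<in>A. (c x)\<^sup>2)"
    have S: "S \<ge> 0"
      by (simp add: S_def sum_nonneg)
    have q_nonneg: "q v \<ge> 0" for v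
      unfolding q_def by (rule gaussian_form_nonneg) simp
    have q_ge: "q v \<ge> S / 2" if v: "0 < v" "v \<le> v0" for v
      unfolding q_def S_def
    proof (rule form_diagonally_dominant[OF \<open>finite A\<close>, where \<eta> = "4 * v\<^sup>2 / \<delta>\<^sup>2"])
      fix x y assume "x \<in> A" "y \<in> A" "x \<noteq> y"
      then have "\<delta> \<le> norm (x - y)"
        using A(3) by (auto simp: pairwise_def)
      then have "\<delta>\<^sup>2 \<le> (norm (x - y))\<^sup>2"
        using assms by (intro power_mono) auto
      then have le: "\<delta>\<^sup>2 / (4 * v\<^sup>2) \<le> 1 / (4 * v\<^sup>2) * (norm (x - y))\<^sup>2"
        by (simp add: divide_right_mono)
      \<comment> \<open>The off-diagonal entries are estimated by
        \<open>exp (- s) \<le> 1 / s\<close> with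
        \<open>s = \<delta>\<^sup>2 / (4 * v\<^sup>2)\<close>.\<close>
      have "\<delta>\<^sup>2 / (4 * v\<^sup>2) \<le> exp (\<delta>\<^sup>2 / (4 * v\<^sup>2))"
        using exp_ge_add_one_self[of "\<delta>\<^sup>2 / (4 * v\<^sup>2)"] by linarith
      then have "inverse (exp (\<delta>\<^sup>2 / (4 * v\<^sup>2))) \<le> inverse (\<delta>\<^sup>2 / (4 * v\<^sup>2))"
        using assms v by (intro le_imp_inverse_le) auto
      moreover have "exp (- (1 / (4 * v\<^sup>2) * (norm (x - y))\<^sup>2)) \<le> exp (- (\<delta>\<^sup>2 / (4 * v\<^sup>2)))"
        using le by simp
      ultimately have "exp (- (1 / (4 * v\<^sup>2) * (norm (x - y))\<^sup>2)) \<le> inverse (\<delta>\<^sup>2 / (4 * v\<^sup>2))"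
        unfolding exp_minus by linarith
      then show "\<bar>exp (- (1 / (4 * v\<^sup>2) * (norm (x - y))\<^sup>2))\<bar> \<le> 4 * v\<^sup>2 / \<delta>\<^sup>2"
        by simp
    next
      have "4 * v\<^sup>2 / \<delta>\<^sup>2 \<le> 4 * v0\<^sup>2 / \<delta>\<^sup>2"
        using v by (intro divide_right_mono mult_left_mono power_mono) auto
      also have "\<dots> = 1 / (4 * (real n)\<^sup>2)"
        using assms by (simp add: v0_def power_divide power_mult_distrib)
      finally have "real (card A) * (4 * v\<^sup>2 / \<delta>\<^sup>2) \<le> real n * (1 / (4 * (real n)\<^sup>2))"
        using A(2) by (intro mult_mono) auto
      also have "\<dots> = 1 / (4 * real n)"
        by (simp add: power2_eq_square)
      also have "\<dots> \<le> 1 / 2"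
        using assms by (simp add: divide_simps)
      finally show "real (card A) * (4 * v\<^sup>2 / \<delta>\<^sup>2) \<le> 1 / 2" .
    qed auto
    \<comment> \<open>The increment of \<open>H\<close> over \<open>(0, \<infinity>)\<close> is \<open>C\<close> times the form, its increment over \<open>(0, v0]\<close>
      is at least \<open>\<kappa> * v0\<close>.\<close>
    define H where "H v = (\<Sum>x\<in>A. \<Sum>y\<in>A. c x * c y * F (norm (x - y) / 2) v)" for v
    have dH: "(H has_real_derivative exp (- v\<^sup>2) * q v) (at v)" if "v > 0" for v
    proof -
      have "(H has_real_derivative (\<Sum>x\<in>A. \<Sum>y\<in>A. c x * c y *
          (exp (- v\<^sup>2) * exp (- (norm (x - y) / 2 / v)\<^sup>2)))) (at v)"
        unfolding H_def by (intro DERIV_sum DERIV_cmult F(1) that) simp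
      also have "(\<Sum>x\<in>A. \<Sum>y\<in>A. c x * c y * (exp (- v\<^sup>2) * exp (- (norm (x - y) / 2 / v)\<^sup>2))) =
          exp (- v\<^sup>2) * q v"
        by (simp add: q_def sum_distrib_left power_divide power_mult_distrib mult_ac)
      finally show ?thesis .
    qed
    have lim_top: "(H \<longlongrightarrow> (\<Sum>x\<in>A. \<Sum>y\<in>A. c x * c y *
        ((exp (2 * (norm (x - y) / 2)) + exp (- (2 * (norm (x - y) / 2)))) / 2 * C))) at_top"
      unfolding H_def by (intro tendsto_sum tendsto_mult tendsto_const F(2)) simp
    have lim_0: "(H \<longlongrightarrow> (\<Sum>x\<in>A. \<Sum>y\<in>A. c x * c y *
        ((exp (2 * (norm (x - y) / 2)) - exp (- (2 * (norm (x - y) / 2)))) / 2 * C))) (at_right 0)"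
      unfolding H_def by (intro tendsto_sum tendsto_mult tendsto_const F(3)) simp
    define \<kappa> where "\<kappa> = exp (- v0\<^sup>2) * (S / 2)"
    have "\<forall>\<^sub>F v in at_top. H v0 \<le> H v"
      using eventually_ge_at_top[of v0]
    proof eventually_elim
      case (elim v)
      show ?case
      proof (rule DERIV_nonneg_imp_nondecreasing[OF elim])
        fix u assume "v0 \<le> u"
        then have "u > 0"
          using v0 by linarith
        moreover have "0 \<le> exp (- u\<^sup>2) * q u"
          using q_nonneg by simp
        ultimately show "\<exists>D. (H has_real_derivative D) (at u) \<and> 0 \<le> D"
          using dH by blast
      qed
    qed
    then have 1: "H v0 \<le> (\<Sum>x\<in>A. \<Sum>y\<in>A. c x * c y *
        ((exp (2 * (norm (x - y) / 2)) + exp (- (2 * (norm (x - y) / 2)))) / 2 * C))" (is "_ \<le> ?Htop")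
      by (intro tendsto_lowerbound[OF lim_top]) auto
    \<comment> \<open>Subtracting \<open>\<kappa> * v\<close> turns the lower bound
      \<open>\<kappa>\<close> on the derivative into monotonicity. The inequality then passes to the
      right-hand limit at \<open>0\<close>, since \<open>H\<close> itself divides by
      \<open>v\<close>.\<close>
    have "\<forall>\<^sub>F v in at_right 0. H v - \<kappa> * v \<le> H v0 - \<kappa> * v0"
    proof -
      have "\<forall>\<^sub>F v in at_right 0. v \<in> {0<..<v0}"
        using v0 by (rule eventually_at_right_real)
      then show ?thesis
      proof eventually_elim
        case (elim v)
        show ?case
        proof (rule DERIV_nonneg_imp_nondecreasing[where f = "\<lambda>v. H v - \<kappa> * v"])
          fix u assume u: "v \<le> u" "u \<le> v0"
          with elim have "0 < u" by simp
          have "exp (- v0\<^sup>2) \<le> exp (- u\<^sup>2)"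
            using u \<open>0 < u\<close> by (simp add: power_mono)
          then have "\<kappa> \<le> exp (- u\<^sup>2) * q u"
            unfolding \<kappa>_def using q_ge[OF \<open>0 < u\<close> u(2)] S by (intro mult_mono) auto
          moreover have "((\<lambda>v. H v - \<kappa> * v) has_real_derivative exp (- u\<^sup>2) * q u - \<kappa>) (at u)"
            using DERIV_diff[OF dH[OF \<open>0 < u\<close>] DERIV_cmult_Id[of \<kappa>]] by simp
          ultimately show "\<exists>D. ((\<lambda>v. H v - \<kappa> * v) has_real_derivative D) (at u) \<and> 0 \<le> D"
            by (intro exI[of _ "exp (- u\<^sup>2) * q u - \<kappa>"]) simp
        qed (use elim in simp)
      qed
    qed
    moreover have "((\<lambda>v. H v - \<kappa> * v) \<longlongrightarrow> (\<Sum>x\<in>A. \<Sum>y\<in>A. c x * c y *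
        ((exp (2 * (norm (x - y) / 2)) - exp (- (2 * (norm (x - y) / 2)))) / 2 * C)) - \<kappa> * 0) (at_right 0)"
      (is "(_ \<longlongrightarrow> ?H0 - _) _")
      by (intro tendsto_diff lim_0 tendsto_intros)
    ultimately have 2: "?H0 \<le> H v0 - \<kappa> * v0"
      using tendsto_upperbound[of "\<lambda>v. H v - \<kappa> * v"] by fastforce
    \<comment> \<open>With \<open>2 * a = norm (x - y)\<close>, the terms \<open>exp (2 * a)\<close>
      cancel and the two halves of \<open>exp (- (2 * a))\<close> add up.\<close>
    have "?Htop - ?H0 = C * (\<Sum>x\<in>A. \<Sum>y\<in>A. c x * c y * exp (- norm (x - y)))"
      unfolding sum_subtractf[symmetric] sum_distrib_left
      by (intro sum.cong refl) (simp add: field_simps)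
    with 1 2 have "\<kappa> * v0 \<le> C * (\<Sum>x\<in>A. \<Sum>y\<in>A. c x * c y * exp (- norm (x - y)))"
      by linarith
    moreover have "\<kappa> * v0 = C * (\<mu> * S)"
      using C by (simp add: \<kappa>_def \<mu>_def)
    ultimately show ?thesis
      using C by (simp add: S_def)
  qed
  ultimately show ?thesis
    by blast
qed

section \<open>Weightings and the Lipschitz bound for magnitude\<close>

lemma exp_minus_diff_le:
  fixes p q :: real
  assumes "p \<ge> 0" "q \<ge> 0"
  shows "\<bar>exp (- p) - exp (- q)\<bar> \<le> \<bar>p - q\<bar>"
proof -
  have *: "exp (- p) - exp (- q) \<le> q - p" if "0 \<le> p" "p \<le> q" for p q :: real
  proof -
    have "exp (- p) - exp (- q) = exp (- p) * (1 - exp (- (q - p)))"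
      by (simp add: right_diff_distrib exp_add[symmetric])
    also have "\<dots> \<le> 1 * (q - p)"
      proof (rule mult_mono)
      show "1 - exp (- (q - p)) \<le> q - p"
        using exp_ge_add_one_self[of "- (q - p)"] by linarith
    qed (use that in auto)
    finally show ?thesis by simp
  qed
  show ?thesis
    using *[of p q] *[of q p] assms by (cases "p \<le> q") auto
qed

text \<open>Coercivity makes the similarity matrix invertible, and the row sums of the inverse form
  the weighting \<open>w\<close>. As the form at \<open>w\<close> collapses to the sum of
  \<open>w\<close>, Cauchy-Schwarz gives \<open>\<mu> * S\<^sup>2 \<le> card A * S\<close> for the
  \<open>l^1\<close>-norm \<open>S\<close>.\<close>

lemma magnitude_weighting:
  fixes A :: "(real ^ 'd) set"
  assumes "finite A" and "\<mu> > 0"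
    and coercive: "\<And>c. \<mu> * (\<Sum>x\<in>A. (c x)\<^sup>2) \<le> (\<Sum>x\<in>A. \<Sum>y\<in>A. c x * c y * exp (- norm (x - y)))"
  shows "\<exists>w. (\<forall>x\<in>A. (\<Sum>y\<in>A. exp (- norm (x - y)) * w y) = 1) \<and>
    magnitude A = (\<Sum>x\<in>A. w x) \<and> (\<Sum>x\<in>A. \<bar>w x\<bar>) \<le> real (card A) / \<mu>"
proof -
  \<comment> \<open>The same choice as inside \<open>magnitude\<close>, so that unfolding
    \<open>magnitude A\<close> yields exactly the matrix \<open>Z\<close> below.\<close>
  define as where "as = (SOME as. distinct as \<and> set as = A)"
  have "\<exists>as. distinct as \<and> set as = A"
    using finite_distinct_list[OF \<open>finite A\<close>] by blast
  then have as: "distinct as" "set as = A"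
    unfolding as_def by (metis (mono_tags, lifting) someI_ex)+
  define m where "m = length as"
  define Z where "Z = similarity_matrix as"
  have Z: "Z \<in> carrier_mat m m"
    and Z_index: "\<And>i j. i < m \<Longrightarrow> j < m \<Longrightarrow> Z $$ (i, j) = exp (- norm (as ! i - as ! j))"
    by (simp_all add: Z_def similarity_matrix_def m_def)
  have bij: "bij_betw ((!) as) {..<m} A"
    using bij_betw_nth[OF as(1)] as(2) by (simp add: m_def)
  define ix where "ix = inv_into {..<m} ((!) as)"
  have ix: "ix (as ! i) = i" if "i < m" for i
    using that bij by (simp add: ix_def bij_betw_def inv_into_f_f)
  have sum_A: "(\<Sum>x\<in>A. g x) = (\<Sum>i<m. g (as ! i))" for g :: "real ^ 'd \<Rightarrow> real"
    by (rule sum.reindex_bij_betw[OF bij, symmetric])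
  \<comment> \<open>A kernel vector, read as a function on \<open>A\<close> through
    \<open>ix\<close>, annihilates the form and is therefore zero by coercivity.\<close>
  have "Determinant.det Z \<noteq> 0"
  proof
    assume "Determinant.det Z = 0"
    then obtain v where v: "v \<in> carrier_vec m" "v \<noteq> 0\<^sub>v m" "Z *\<^sub>v v = 0\<^sub>v m"
      using det_0_iff_vec_prod_zero[OF Z] by blast
    have Zv: "(\<Sum>j<m. Z $$ (i, j) * vec_index v j) = 0" if "i < m" for i
    proof -
      have "(\<Sum>j<m. Z $$ (i, j) * vec_index v j) = vec_index (Z *\<^sub>v v) i"
        using that Z v(1) by (simp add: scalar_prod_def atLeast0LessThan)
      then show ?thesis
        using that v(3) by simp
    qed
    have "(\<Sum>x\<in>A. \<Sum>y\<in>A. vec_index v (ix x) * vec_index v (ix y) * exp (- norm (x - y))) =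
        (\<Sum>i<m. vec_index v i * (\<Sum>j<m. Z $$ (i, j) * vec_index v j))"
      by (simp add: sum_A ix Z_index sum_distrib_left mult_ac)
    also have "\<dots> = 0"
      by (simp add: Zv)
    finally have "\<mu> * (\<Sum>i<m. (vec_index v i)\<^sup>2) \<le> 0"
      using coercive[of "\<lambda>x. vec_index v (ix x)"] by (simp add: sum_A ix)
    then have "(\<Sum>i<m. (vec_index v i)\<^sup>2) \<le> 0"
      using \<open>\<mu> > 0\<close> by (simp add: mult_le_0_iff)
    then have "(\<Sum>i<m. (vec_index v i)\<^sup>2) = 0"
      by (intro antisym sum_nonneg) auto
    then have "vec_index v i = 0" if "i < m" for i
      using that by (simp add: sum_nonneg_eq_0_iff)
    then have "v = 0\<^sub>v m"
      using v(1) by (intro eq_vecI) auto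
    with v(2) show False by contradiction
  qed
  then have "mat_inverse Z \<noteq> None"
    using mat_inverse(1)[OF Z, where b = "()"] det_non_zero_imp_unit[OF Z, where b = "()"] by blast
  then obtain B where B: "mat_inverse Z = Some B"
    by blast
  then have ZB: "Z * B = 1\<^sub>m m" and B_carrier: "B \<in> carrier_mat m m"
    using mat_inverse(2)[OF Z B] by auto
  define w where "w x = (\<Sum>j<m. B $$ (ix x, j))" for x
  have mag: "magnitude A = (\<Sum>x\<in>A. w x)"
    unfolding sum_A by (simp add: w_def ix magnitude_def Let_def B flip: as_def Z_def m_def)
  have weight: "(\<Sum>y\<in>A. exp (- norm (x - y)) * w y) = 1" if x: "x \<in> A" for x
  proof -
    obtain i where i: "i < m" "x = as ! i"
      using x as(2) by (metis in_set_conv_nth m_def)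
    have "(\<Sum>y\<in>A. exp (- norm (x - y)) * w y) = (\<Sum>k<m. \<Sum>j<m. Z $$ (i, k) * B $$ (k, j))"
      using i by (simp add: sum_A w_def ix Z_index sum_distrib_left)
    also have "\<dots> = (\<Sum>j<m. \<Sum>k<m. Z $$ (i, k) * B $$ (k, j))"
      by (rule sum.swap)
    also have "\<dots> = (\<Sum>j<m. (Z * B) $$ (i, j))"
      using i Z B_carrier
      by (intro sum.cong refl) (simp add: times_mat_def scalar_prod_def atLeast0LessThan)
    also have "\<dots> = (\<Sum>j<m. if i = j then 1 else 0)"
      using i by (intro sum.cong refl) (simp add: ZB)
    also have "\<dots> = 1"
      using i by simp
    finally show ?thesis .
  qed
  define S where "S = (\<Sum>x\<in>A. \<bar>w x\<bar>)"
  have "S \<ge> 0"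
    by (simp add: S_def sum_nonneg)
  have "S\<^sup>2 \<le> (\<Sum>x\<in>A. 1\<^sup>2) * (\<Sum>x\<in>A. \<bar>w x\<bar>\<^sup>2)"
    using Cauchy_Schwarz_ineq_sum[of "\<lambda>_. 1" "\<lambda>x. \<bar>w x\<bar>" A] by (simp add: S_def)
  then have "\<mu> * S\<^sup>2 \<le> \<mu> * (real (card A) * (\<Sum>x\<in>A. (w x)\<^sup>2))"
    using \<open>\<mu> > 0\<close> by simp
  also have "\<dots> = real (card A) * (\<mu> * (\<Sum>x\<in>A. (w x)\<^sup>2))"
    by simp
  also have "\<dots> \<le> real (card A) * (\<Sum>x\<in>A. \<Sum>y\<in>A. w x * w y * exp (- norm (x - y)))"
    by (intro mult_left_mono coercive) simp
  also have "(\<Sum>x\<in>A. \<Sum>y\<in>A. w x * w y * exp (- norm (x - y))) =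
      (\<Sum>x\<in>A. w x * (\<Sum>y\<in>A. exp (- norm (x - y)) * w y))"
    by (simp add: sum_distrib_left mult_ac)
  also have "\<dots> = (\<Sum>x\<in>A. w x)"
    by (simp add: weight)
  also have "real (card A) * (\<Sum>x\<in>A. w x) \<le> real (card A) * S"
    unfolding S_def by (intro mult_left_mono sum_mono) auto
  finally have "S * (\<mu> * S) \<le> S * real (card A)"
    by (simp add: power2_eq_square mult_ac)
  then have "\<mu> * S \<le> real (card A)"
    using \<open>S \<ge> 0\<close> by (cases "S = 0") auto
  then have "S \<le> real (card A) / \<mu>"
    using \<open>\<mu> > 0\<close> by (simp add: field_simps)
  with weight mag show ?thesis
    unfolding S_def by blast
qed

text \<open>\<open>M = n / \<mu>\<close> bounds the \<open>l^1\<close>-norm of every weighting,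
  hence the magnitudes; the bilinear estimate involves two weightings and so costs
  \<open>M\<^sup>2\<close>.\<close>

lemma magnitude_lipschitz:
  fixes \<delta> :: real and n :: nat
  assumes "n \<ge> 1" "\<delta> > 0"
  shows "\<exists>M>0. (\<forall>A :: (real ^ 'd) set. separated n \<delta> A \<longrightarrow> \<bar>magnitude A\<bar> \<le> M) \<and>
    (\<forall>(A :: (real ^ 'd) set) B \<gamma> \<epsilon>. separated n \<delta> A \<longrightarrow> separated n \<delta> B \<longrightarrow> bij_betw \<gamma> A B \<longrightarrow>
      (\<forall>x\<in>A. norm (x - \<gamma> x) \<le> \<epsilon>) \<longrightarrow> \<epsilon> \<ge> 0 \<longrightarrow>
      \<bar>magnitude A - magnitude B\<bar> \<le> 2 * \<epsilon> * M\<^sup>2)"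
proof -
  obtain \<mu> where "\<mu> > 0" and coercive: "\<forall>(A :: (real ^ 'd) set) c. separated n \<delta> A \<longrightarrow>
      \<mu> * (\<Sum>x\<in>A. (c x)\<^sup>2) \<le> (\<Sum>x\<in>A. \<Sum>y\<in>A. c x * c y * exp (- norm (x - y)))"
    using exponential_form_coercive[OF assms] by blast
  define M where "M = real n / \<mu>"
  have "M > 0"
    using assms \<open>\<mu> > 0\<close> by (simp add: M_def)
  have weighting: "\<exists>w. (\<forall>x\<in>A. (\<Sum>y\<in>A. exp (- norm (x - y)) * w y) = 1) \<and>
      magnitude A = (\<Sum>x\<in>A. w x) \<and> (\<Sum>x\<in>A. \<bar>w x\<bar>) \<le> M"
    if A: "separated n \<delta> A" for A :: "(real ^ 'd) set"
  proof -
    have fin: "finite A" "card A \<le> n"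
      using A by (auto simp: separated_def)
    have "real (card A) / \<mu> \<le> M"
      unfolding M_def using fin(2) \<open>\<mu> > 0\<close> by (intro divide_right_mono) auto
    with magnitude_weighting[OF fin(1) \<open>\<mu> > 0\<close> coercive[rule_format, OF A]] show ?thesis
      by fastforce
  qed
  have bound: "\<bar>magnitude A\<bar> \<le> M"
    if A: "separated n \<delta> A" for A :: "(real ^ 'd) set"
  proof -
    obtain w where "magnitude A = (\<Sum>x\<in>A. w x)" "(\<Sum>x\<in>A. \<bar>w x\<bar>) \<le> M"
      using weighting[OF A] by blast
    then show ?thesis
      using sum_abs[of w A] by linarith
  qed
  have lip: "\<bar>magnitude A - magnitude B\<bar> \<le> 2 * \<epsilon> * M\<^sup>2"
    if A: "separated n \<delta> A"
      and B: "separated n \<delta> B" and \<gamma>: "bij_betw \<gamma> A B"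
      and \<epsilon>: "\<forall>x\<in>A. norm (x - \<gamma> x) \<le> \<epsilon>" "\<epsilon> \<ge> 0"
    for A B :: "(real ^ 'd) set" and \<gamma> \<epsilon>
  proof -
    obtain w where w: "\<And>x. x \<in> A \<Longrightarrow> (\<Sum>y\<in>A. exp (- norm (x - y)) * w y) = 1"
      "magnitude A = (\<Sum>x\<in>A. w x)" "(\<Sum>x\<in>A. \<bar>w x\<bar>) \<le> M"
      using weighting[OF A] by blast
    obtain u where u: "\<And>x. x \<in> B \<Longrightarrow> (\<Sum>y\<in>B. exp (- norm (x - y)) * u y) = 1"
      "magnitude B = (\<Sum>x\<in>B. u x)" "(\<Sum>x\<in>B. \<bar>u x\<bar>) \<le> M"
      using weighting[OF B] by blast
    have sum_B: "(\<Sum>y\<in>B. g y) = (\<Sum>x\<in>A. g (\<gamma> x))" for g :: "real ^ 'd \<Rightarrow> real"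
      by (rule sum.reindex_bij_betw[OF \<gamma>, symmetric])
    have \<gamma>B: "\<gamma> x \<in> B" if "x \<in> A" for x
      using that \<gamma> by (auto simp: bij_betw_def)
    \<comment> \<open>The weighting equation of \<open>B\<close> at \<open>\<gamma> x\<close>
      inserts a factor \<open>1\<close>, and that of \<open>A\<close> does the same for
      \<open>magnitude B\<close>. Both become bilinear forms in the same \<open>w\<close> and
      \<open>u\<close>, with the kernels interchanged.\<close>
    have "magnitude A = (\<Sum>x\<in>A. w x * (\<Sum>y\<in>A. exp (- norm (\<gamma> x - \<gamma> y)) * u (\<gamma> y)))"
      using u(1)[OF \<gamma>B] by (simp add: w(2) sum_B)
    then have mA: "magnitude A = (\<Sum>x\<in>A. \<Sum>y\<in>A. w x * u (\<gamma> y) * exp (- norm (\<gamma> x - \<gamma> y)))"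
      by (simp add: sum_distrib_left mult_ac)
    have "magnitude B = (\<Sum>y\<in>A. u (\<gamma> y) * (\<Sum>x\<in>A. exp (- norm (y - x)) * w x))"
      by (simp add: w(1) u(2) sum_B)
    also have "\<dots> = (\<Sum>y\<in>A. \<Sum>x\<in>A. w x * u (\<gamma> y) * exp (- norm (x - y)))"
      by (simp add: sum_distrib_left mult_ac norm_minus_commute)
    also have "\<dots> = (\<Sum>x\<in>A. \<Sum>y\<in>A. w x * u (\<gamma> y) * exp (- norm (x - y)))"
      by (rule sum.swap)
    finally have "magnitude A - magnitude B = (\<Sum>x\<in>A. \<Sum>y\<in>A. w x * u (\<gamma> y) *
        (exp (- norm (\<gamma> x - \<gamma> y)) - exp (- norm (x - y))))"
      by (simp add: mA sum_subtractf right_diff_distrib)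
    also have "\<bar>\<dots>\<bar> \<le> (\<Sum>x\<in>A. \<Sum>y\<in>A. \<bar>w x\<bar> * \<bar>u (\<gamma> y)\<bar> * (2 * \<epsilon>))"
    proof (intro order_trans[OF sum_abs] sum_mono)
      fix x y assume xy: "x \<in> A" "y \<in> A"
      \<comment> \<open>Both endpoints of a distance move by at most \<open>\<epsilon>\<close>,
        whence the factor \<open>2\<close>.\<close>
      have "\<bar>exp (- norm (\<gamma> x - \<gamma> y)) - exp (- norm (x - y))\<bar> \<le> \<bar>norm (\<gamma> x - \<gamma> y) - norm (x - y)\<bar>"
        by (intro exp_minus_diff_le) auto
      also have "\<dots> \<le> norm ((\<gamma> x - \<gamma> y) - (x - y))"
        by (rule norm_triangle_ineq3)
      also have "\<dots> = norm ((y - \<gamma> y) - (x - \<gamma> x))"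
        by (simp add: algebra_simps)
      also have "\<dots> \<le> 2 * \<epsilon>"
        using norm_triangle_ineq4[of "y - \<gamma> y" "x - \<gamma> x"] bspec[OF \<epsilon>(1) xy(1)] bspec[OF \<epsilon>(1) xy(2)]
          by linarith
      finally show "\<bar>w x * u (\<gamma> y) * (exp (- norm (\<gamma> x - \<gamma> y)) - exp (- norm (x - y)))\<bar> \<le>
          \<bar>w x\<bar> * \<bar>u (\<gamma> y)\<bar> * (2 * \<epsilon>)"
        unfolding abs_mult by (intro mult_left_mono) auto
    qed
    also have "\<dots> = (\<Sum>x\<in>A. \<bar>w x\<bar>) * (\<Sum>y\<in>B. \<bar>u y\<bar>) * (2 * \<epsilon>)"
      unfolding sum_B sum_product by (simp add: sum_distrib_right)
    also have "\<dots> \<le> M * M * (2 * \<epsilon>)"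
      using w(3) u(3) \<open>M > 0\<close> \<epsilon>(2) by (intro mult_right_mono mult_mono) (auto intro: sum_nonneg)
    finally show ?thesis
      by (simp add: power2_eq_square mult_ac)
  qed
  show ?thesis
    using \<open>M > 0\<close> bound lip by (intro exI[of _ M]) simp
qed

section \<open>Magnitude profiles of thick configurations\<close>

lemma thick_config_setsD:
  fixes X :: "(real ^ 'd) set"
  assumes "X \<in> thick_config_sets n \<delta>" "\<delta> > 0"
  shows "finite X" "card X = n" "barycenter X = 0" "pairwise (\<lambda>x y. \<delta> \<le> norm (x - y)) X"
proof -
  obtain xs :: "(real ^ 'd) list" where xs: "X = set xs" "length xs = n" "sum_list xs = 0"
    and sep: "\<And>i j. i < n \<Longrightarrow> j < n \<Longrightarrow> i \<noteq> j \<Longrightarrow> \<delta> \<le> norm (xs ! i - xs ! j)"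
    using assms by (auto simp: thick_config_sets_def thick_config_def)
  have "xs ! i \<noteq> xs ! j" if "i < n" "j < n" "i \<noteq> j" for i j
    using sep[OF that] \<open>\<delta> > 0\<close> by auto
  \<comment> \<open>Distinctness identifies the sum of the list with the sum over the set, so the
    barycenter is the origin.\<close>
  then have "distinct xs"
    using xs(2) by (auto simp: distinct_conv_nth)
  then show "finite X" "card X = n" "barycenter X = 0"
    using xs by (auto simp: distinct_card barycenter_def sum_list_distinct_conv_sum_set[of xs "\<lambda>x. x", simplified])
  show "pairwise (\<lambda>x y. \<delta> \<le> norm (x - y)) X"
    using sep xs(2) by (fastforce simp: pairwise_def xs(1) in_set_conv_nth)
qed

text \<open>Used to bound the total length of the radii at which a ball may separate a point from
  its partner.\<close>

lemma integral_indicator_interval_le: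
  fixes a b L :: real
  shows "(indicat_real {a..b}) integrable_on {0..L}"
    and "a \<le> b \<Longrightarrow> integral {0..L} (indicat_real {a..b}) \<le> b - a"
proof -
  have *: "{a..b} \<inter> {0..L} \<in> lmeasurable"
    by (metis Int_atLeastAtMost lmeasurable_interval(1) box_real(2) lmeasurable_cbox)
  then show "(indicat_real {a..b}) integrable_on {0..L}"
    by (simp add: integrable_on_indicator)
  assume "a \<le> b"
  have "integral {0..L} (indicat_real {a..b}) = measure lebesgue ({a..b} \<inter> {0..L})"
    by (rule integral_indicator[OF *])
  also have "\<dots> \<le> measure lebesgue {a..b}"
    by (rule measure_mono_fmeasurable) (use * in auto)
  finally show "integral {0..L} (indicat_real {a..b}) \<le> b - a"
    using \<open>a \<le> b\<close> by simp
qed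

theorem theorem1p4:
  fixes n :: nat and L \<delta> :: real
  assumes "n \<ge> 1" and "L > 0" and "\<delta> > 0"
  shows "\<exists>K::real. \<forall>X Y :: (real ^ 'd) set.
           X \<in> thick_config_sets n \<delta> \<longrightarrow> Y \<in> thick_config_sets n \<delta> \<longrightarrow>
           X \<subseteq> cball 0 L \<longrightarrow> Y \<subseteq> cball 0 L \<longrightarrow>
           L1_dist L (magnitude_profile X) (magnitude_profile Y) \<le> K * W_inf_dist X Y"
proof -
  obtain M where "M > 0"
    and bound: "\<And>A :: (real ^ 'd) set. separated n \<delta> A \<Longrightarrow> \<bar>magnitude A\<bar> \<le> M"
    and lip: "\<And>(A :: (real ^ 'd) set) B \<gamma> \<epsilon>. separated n \<delta> A \<Longrightarrow> separated n \<delta> B \<Longrightarrow>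
      bij_betw \<gamma> A B \<Longrightarrow> \<forall>x\<in>A. norm (x - \<gamma> x) \<le> \<epsilon> \<Longrightarrow> \<epsilon> \<ge> 0 \<Longrightarrow>
      \<bar>magnitude A - magnitude B\<bar> \<le> 2 * \<epsilon> * M\<^sup>2"
    using magnitude_lipschitz[OF assms(1,3), where 'd = 'd] by metis
  \<comment> \<open>The first term is the Lipschitz bound integrated over \<open>{0..L}\<close>; the
    second allows an error of \<open>2 * M\<close> on \<open>n\<close> intervals of length at most
    \<open>\<epsilon>\<close>.\<close>
  define K where "K = 2 * M\<^sup>2 * L + 2 * M * real n"
  have "K > 0"
    using \<open>M > 0\<close> assms by (simp add: K_def add_pos_pos)
  have L1_le: "L1_dist L (magnitude_profile X) (magnitude_profile Y) \<le> K * \<epsilon>"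
    if X: "X \<in> thick_config_sets n \<delta>" and Y: "Y \<in> thick_config_sets n \<delta>"
      and \<gamma>: "bij_betw \<gamma> X Y" and \<epsilon>: "\<forall>x\<in>X. norm (x - \<gamma> x) \<le> \<epsilon>" "\<epsilon> \<ge> 0"
    for X Y :: "(real ^ 'd) set" and \<gamma> \<epsilon>
  proof -
    note X' = thick_config_setsD[OF X \<open>\<delta> > 0\<close>] and Y' = thick_config_setsD[OF Y \<open>\<delta> > 0\<close>]
    \<comment> \<open>A radius outside \<open>{lo x..hi x}\<close> puts \<open>x\<close> and
      \<open>\<gamma> x\<close> both inside or both outside the ball.\<close>
    define lo hi where "lo x = min (norm x) (norm (\<gamma> x))" and "hi x = max (norm x) (norm (\<gamma> x))"
      for x :: "real ^ 'd"
    have nbhd: "barycentric_nbhd r X = {x \<in> X. norm x \<le> r}" "barycentric_nbhd r Y = {y \<in> Y. norm y \<le> r}"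
      for r
      using X'(3) Y'(3) by (auto simp: barycentric_nbhd_def)
    have sep: "separated n \<delta> (barycentric_nbhd r X)" "separated n \<delta> (barycentric_nbhd r Y)" for r
      using X' Y' by (auto simp: nbhd separated_def pairwise_def intro: order_trans[OF card_mono])
    have le: "\<bar>magnitude_profile X r - magnitude_profile Y r\<bar> \<le>
        2 * \<epsilon> * M\<^sup>2 + 2 * M * (\<Sum>x\<in>X. indicat_real {lo x..hi x} r)" for r
    proof (cases "\<exists>x\<in>X. r \<in> {lo x..hi x}")
      case True
      then obtain x where x: "x \<in> X" "r \<in> {lo x..hi x}"
        by blast
      have "1 = indicat_real {lo x..hi x} r"
        using x by simp
      also have "\<dots> \<le> (\<Sum>x\<in>X. indicat_real {lo x..hi x} r)"
        using x X' by (intro member_le_sum) auto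
      finally have "2 * M * 1 \<le> 2 * M * (\<Sum>x\<in>X. indicat_real {lo x..hi x} r)"
        using \<open>M > 0\<close> by (intro mult_left_mono) auto
      moreover have "\<bar>magnitude_profile X r - magnitude_profile Y r\<bar> \<le> 2 * M"
        using bound[OF sep(1)[of r]] bound[OF sep(2)[of r]] unfolding magnitude_profile_def by linarith
      moreover have "0 \<le> 2 * \<epsilon> * M\<^sup>2"
        using \<epsilon> by simp
      ultimately show ?thesis
        by linarith
    next
      case False
      then have iff: "norm (\<gamma> x) \<le> r \<longleftrightarrow> norm x \<le> r" if "x \<in> X" for x
        using that by (auto simp: lo_def hi_def min_def max_def split: if_splits)
      \<comment> \<open>No pair is split at this radius, so \<open>\<gamma>\<close> restricts to the
        neighbourhoods.\<close>
      have "bij_betw \<gamma> (barycentric_nbhd r X) (barycentric_nbhd r Y)"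
        using \<gamma> iff by (auto simp: nbhd bij_betw_def inj_on_def)
      then have "\<bar>magnitude_profile X r - magnitude_profile Y r\<bar> \<le> 2 * \<epsilon> * M\<^sup>2"
        unfolding magnitude_profile_def using \<epsilon> by (intro lip[OF sep]) (auto simp: nbhd)
      moreover have "0 \<le> 2 * M * (\<Sum>x\<in>X. indicat_real {lo x..hi x} r)"
        using \<open>M > 0\<close> by (simp add: sum_nonneg)
      ultimately show ?thesis
        by linarith
    qed
    have K_nonneg: "0 \<le> K * \<epsilon>"
      using \<open>K > 0\<close> \<epsilon> by simp
    show ?thesis
    proof (cases "(\<lambda>r. \<bar>magnitude_profile X r - magnitude_profile Y r\<bar>) integrable_on {0..L}")
      case False
      \<comment> \<open>The integral of a non-integrable function is \<open>0\<close>, so measurability of the profiles is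
        not an issue.\<close>
      then show ?thesis
        using K_nonneg by (simp add: L1_dist_def not_integrable_integral)
    next
      case True
      have hi_lo: "hi x - lo x \<le> \<epsilon>" "lo x \<le> hi x" if "x \<in> X" for x
        using norm_triangle_ineq3[of x "\<gamma> x"] \<epsilon>(1) that by (auto simp: lo_def hi_def)
      note int_ind = integral_indicator_interval_le
      have int: "(\<lambda>r. \<Sum>x\<in>X. indicat_real {lo x..hi x} r) integrable_on {0..L}"
        using X' by (intro integrable_sum int_ind(1))
      have "L1_dist L (magnitude_profile X) (magnitude_profile Y) \<le>
          integral {0..L} (\<lambda>r. 2 * \<epsilon> * M\<^sup>2 + 2 * M * (\<Sum>x\<in>X. indicat_real {lo x..hi x} r))"
        unfolding L1_dist_def
        by (intro integral_le True le integrable_add integrable_const_ivl integrable_on_mult_right int)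
      also have "\<dots> = 2 * \<epsilon> * M\<^sup>2 * L + 2 * M * (\<Sum>x\<in>X. integral {0..L} (indicat_real {lo x..hi x}))"
        using \<open>L > 0\<close> X' int int_ind(1)
        by (simp add: integral_add integral_sum integrable_const_ivl integrable_on_mult_right)
      also have "\<dots> \<le> 2 * \<epsilon> * M\<^sup>2 * L + 2 * M * (\<Sum>x\<in>X. \<epsilon>)"
        using order_trans[OF int_ind(2)[OF hi_lo(2)] hi_lo(1)] \<open>M > 0\<close>
        by (intro add_left_mono mult_left_mono sum_mono) auto
      also have "2 * \<epsilon> * M\<^sup>2 * L + 2 * M * (\<Sum>x\<in>X. \<epsilon>) = K * \<epsilon>"
        using X' by (simp add: K_def algebra_simps)
      finally show ?thesis .
    qed
  qed
  have "L1_dist L (magnitude_profile X) (magnitude_profile Y) \<le> K * W_inf_dist X Y"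
    if X: "X \<in> thick_config_sets n \<delta>" and Y: "Y \<in> thick_config_sets n \<delta>"
    for X Y :: "(real ^ 'd) set"
  proof -
    note X' = thick_config_setsD[OF X \<open>\<delta> > 0\<close>] and Y' = thick_config_setsD[OF Y \<open>\<delta> > 0\<close>]
    have "X \<noteq> {}"
      using X'(2) \<open>n \<ge> 1\<close> by auto
    have "{\<gamma>. bij_betw \<gamma> X Y} \<noteq> {}"
      using finite_same_card_bij[OF X'(1) Y'(1)] X'(2) Y'(2) by auto
    \<comment> \<open>Every bijection is admissible with \<open>\<epsilon>\<close> its largest
      displacement. Dividing by \<open>K\<close> gives a lower bound free of
      \<open>\<gamma>\<close>, which passes to the infimum.\<close>
    moreover have "L1_dist L (magnitude_profile X) (magnitude_profile Y) / K \<le>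
        Max ((\<lambda>x. norm (x - \<gamma> x)) ` X)" if \<gamma>: "\<gamma> \<in> {\<gamma>. bij_betw \<gamma> X Y}" for \<gamma>
    proof -
      have Max: "\<forall>x\<in>X. norm (x - \<gamma> x) \<le> Max ((\<lambda>x. norm (x - \<gamma> x)) ` X)"
        using X'(1) by auto
      moreover have "0 \<le> Max ((\<lambda>x. norm (x - \<gamma> x)) ` X)"
        using Max \<open>X \<noteq> {}\<close> by (meson all_not_in_conv norm_ge_zero order_trans)
      ultimately have "L1_dist L (magnitude_profile X) (magnitude_profile Y) \<le>
          K * Max ((\<lambda>x. norm (x - \<gamma> x)) ` X)"
        using L1_le[OF X Y] \<gamma> by blast
      then show ?thesis
        using \<open>K > 0\<close> by (simp add: pos_divide_le_eq mult.commute)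
    qed
    ultimately have "L1_dist L (magnitude_profile X) (magnitude_profile Y) / K \<le> W_inf_dist X Y"
      unfolding W_inf_dist_def by (rule cINF_greatest)
    then show ?thesis
      using \<open>K > 0\<close> by (simp add: divide_le_eq mult.commute)
  qed
  then show ?thesis
    by blast
qed

end
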